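(* Let $N_1,N_2,\dots$ be positive integers with $N_k\mid N_{k+1}$ for all $k$, and let $d_1,d_2,\dots$ be positive integers. Suppose $f_1,f_2,\dots$ are trigonometric polynomials on $\mathbb{T}$ such that $\deg f_k\le d_k$ and $f_k$ is $\frac{2\pi}{N_k}$-periodic. Then \[(1-C\theta)\|(f_k)\|_{\mathrm{ind}}\le\|(f_k)\|_{L^1(\ell^2)}\le(1+C\theta)\|(f_k)\|_{\mathrm{ind}},\] where $\theta=\sup_k\frac{d_k}{N_{k+1}}$ and $C$ is a numerical constant.
   Context: $\mathbb{T}=\mathbb{R}/2\pi\mathbb{Z}$ with normalized Lebesgue measure $\mu$. $\|(g_k)\|_{L^1(\ell^2)}=\int_{\mathbb{T}}(\sum_k|g_k|^2)^{1/2}d\mu$ and $\|(g_k)\|_{\mathrm{ind}}=\int_{\mathbb{T}^\infty}(\sum_k|g_k(t_k)|^2)^{1/2}d(\mu\otimes\mu\otimes\cdots)(t_1,t_2,\dots)$. *)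

theory Defs
  imports "HOL-Probability.Probability"
begin

definition torus_measure :: "real measure" where
  "torus_measure = uniform_measure lborel {0..<2*pi}"

definition trig_poly_deg_le :: "(real \<Rightarrow> complex) \<Rightarrow> nat \<Rightarrow> bool" where
  "trig_poly_deg_le f d \<longleftrightarrow>
     (\<exists>c :: int \<Rightarrow> complex. \<forall>t. f t = (\<Sum>n\<in>{-int d..int d}. c n * exp (\<i> * of_int n * of_real t)))"

definition sqfun :: "(nat \<Rightarrow> complex) \<Rightarrow> ennreal" where
  "sqfun v = (SUP n. ennreal (sqrt (\<Sum>k<n. (cmod (v k))\<^sup>2)))"

definition L1l2_norm :: "(nat \<Rightarrow> real \<Rightarrow> complex) \<Rightarrow> ennreal" where
  "L1l2_norm g = (\<integral>\<^sup>+ t. sqfun (\<lambda>k. g k t) \<partial>torus_measure)"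

definition ind_norm :: "(nat \<Rightarrow> real \<Rightarrow> complex) \<Rightarrow> ennreal" where
  "ind_norm g = (\<integral>\<^sup>+ \<omega>. sqfun (\<lambda>k. g k (\<omega> k)) \<partial>(PiM UNIV (\<lambda>_. torus_measure)))"

end

theory Submission
  imports Defs
begin

text \<open>
  The variables are decoupled one at a time: the hybrid
  \<open>E sqrt (\<epsilon> + \<Sum>k<n. |f k (\<omega> k)|\<^sup>2 + \<Sum>k\<ge>n. |f k t|\<^sup>2)\<close> interpolates between the two norms.
  Given \<open>A = \<epsilon> + \<Sum>k<n. |f k (\<omega> k)|\<^sup>2\<close>, passing from \<open>n\<close> to \<open>n + 1\<close> amounts to translating \<open>f n\<close>
  by at most \<open>2 pi / N (n + 1)\<close>, because the remaining sum has this period. By a Bernstein inequality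
  in the form \<open>|f'| \<le> 2 d (|f| * F)\<close> with a Fejer average \<open>F\<close>, and Jensen's inequality for the
  convex function \<open>x \<mapsto> sqrt (A + x\<^sup>2) - sqrt A\<close>, the translation costs at most \<open>16 pi \<theta>\<close> times
  \<open>E (sqrt (A + |f n|\<^sup>2) - sqrt A)\<close>. These increments telescope to at most the independent norm,
  so the total error is linear in \<open>\<theta>\<close>, uniformly in the number of steps.
\<close>

section \<open>The convex function\<close>

text \<open>Rationalising writes the difference as |x - y| over the sum of the two roots, and
  \<open>S\<close> only enlarges this denominator. The lemma later removes the not yet decoupled
  tail from the error estimate.\<close>

lemma abs_sqrt_diff_add_le:
  assumes "A > 0" "S \<ge> 0" "x \<ge> 0" "y \<ge> 0"
  shows "\<bar>sqrt (A + x + S) - sqrt (A + y + S)\<bar> \<le> \<bar>sqrt (A + x) - sqrt (A + y)\<bar>"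
proof -
  have *: "\<bar>sqrt (A + x + s) - sqrt (A + y + s)\<bar> = \<bar>x - y\<bar> / (sqrt (A + x + s) + sqrt (A + y + s))"
    if "s \<ge> 0" for s
  proof -
    have p: "sqrt (A + x + s) + sqrt (A + y + s) > 0"
      using assms that by (simp add: add_pos_nonneg add_nonneg_pos)
    have "(sqrt (A + x + s) - sqrt (A + y + s)) * (sqrt (A + x + s) + sqrt (A + y + s)) = x - y"
      using assms that by (simp add: algebra_simps)
    then have "\<bar>sqrt (A + x + s) - sqrt (A + y + s)\<bar> * (sqrt (A + x + s) + sqrt (A + y + s)) = \<bar>x - y\<bar>"
      using p by (metis abs_mult abs_of_pos)
    then show ?thesis using p by (simp add: field_simps)
  qed
  have "\<bar>x - y\<bar> / (sqrt (A + x + S) + sqrt (A + y + S)) \<le> \<bar>x - y\<bar> / (sqrt (A + x + 0) + sqrt (A + y + 0))"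
    using assms by (intro divide_left_mono add_mono mult_pos_pos add_pos_pos) auto
  then show ?thesis using *[of S] *[of 0] assms by simp
qed

text \<open>For \<open>A > 0\<close> this is comparable to the smaller of x^2 / sqrt A and |x|. It
  measures how much the root grows when one more square joins \<open>A\<close>, so it telescopes,
  while its convexity admits Jensen's inequality.\<close>

definition excess :: "real \<Rightarrow> real \<Rightarrow> real" where
  "excess A x = sqrt (A + x\<^sup>2) - sqrt A"

lemma excess_nonneg: "excess A x \<ge> 0"
  by (simp add: excess_def)

lemma continuous_on_excess [continuous_intros]:
  "continuous_on X f \<Longrightarrow> continuous_on X (\<lambda>x. excess A (f x))"
  unfolding excess_def by (intro continuous_intros)

lemma excess_mono:
  assumes "0 \<le> x" "x \<le> y" shows "excess A x \<le> excess A y"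
  using assms by (simp add: excess_def power_mono)

text \<open>Factor x^2 as a difference of squares: \<open>excess A x\<close> times a sum of two
  roots, each at most sqrt(A + x^2).\<close>

lemma square_le_excess:
  assumes "A > 0" shows "x\<^sup>2 / sqrt (A + x\<^sup>2) \<le> 2 * excess A x"
proof -
  have p: "sqrt (A + x\<^sup>2) > 0" "sqrt A > 0" "sqrt A \<le> sqrt (A + x\<^sup>2)"
    using assms by (auto simp: add_pos_nonneg)
  have "x\<^sup>2 = excess A x * (sqrt (A + x\<^sup>2) + sqrt A)"
    using assms by (simp add: excess_def algebra_simps)
  also have "\<dots> \<le> excess A x * (2 * sqrt (A + x\<^sup>2))"
    using p excess_nonneg by (intro mult_left_mono) auto
  finally show ?thesis using p by (simp add: field_simps)
qed

text \<open>A substitute for Young's inequality. It separates the product in the derivative of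
  sqrt(A + |f|^2), with a = |f| and h = |f'| / (2 d). The larger variable takes over: if h is at
  most a, replace h by a; otherwise replace a by h, since a / sqrt(A + a^2) increases in a.\<close>

lemma mult_le_excess:
  assumes A: "A > 0" and "h \<ge> 0" "a \<ge> 0"
  shows "h * a / sqrt (A + a\<^sup>2) \<le> 2 * (excess A h + excess A a)"
proof (cases "h \<le> a")
  case True
  have "h * a / sqrt (A + a\<^sup>2) \<le> a\<^sup>2 / sqrt (A + a\<^sup>2)"
    using True assms by (intro divide_right_mono) (auto simp: power2_eq_square intro: mult_right_mono)
  also have "\<dots> \<le> 2 * excess A a" by (rule square_le_excess[OF A])
  finally show ?thesis using excess_nonneg[of A h] by simp
next
  case False
  then have ah: "a \<le> h" by simp
  have p: "sqrt (A + a\<^sup>2) > 0" "sqrt (A + h\<^sup>2) > 0" using A by (auto simp: add_pos_nonneg)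
  have "a * sqrt (A + h\<^sup>2) \<le> h * sqrt (A + a\<^sup>2)"
  proof (rule power2_le_imp_le)
    have "a\<^sup>2 * A \<le> h\<^sup>2 * A" using ah assms by (intro mult_right_mono power_mono) auto
    then show "(a * sqrt (A + h\<^sup>2))\<^sup>2 \<le> (h * sqrt (A + a\<^sup>2))\<^sup>2"
      using A by (simp add: power_mult_distrib algebra_simps)
  qed (use assms in auto)
  then have "a / sqrt (A + a\<^sup>2) \<le> h / sqrt (A + h\<^sup>2)"
    using p by (simp add: field_simps)
  then have "h * (a / sqrt (A + a\<^sup>2)) \<le> h * (h / sqrt (A + h\<^sup>2))"
    using assms by (intro mult_left_mono)
  then have "h * a / sqrt (A + a\<^sup>2) \<le> h\<^sup>2 / sqrt (A + h\<^sup>2)"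
    by (simp add: power2_eq_square)
  also have "\<dots> \<le> 2 * excess A h" by (rule square_le_excess[OF A])
  finally show ?thesis using excess_nonneg[of A a] by simp
qed

text \<open>sqrt(A + x^2) is the modulus of x + i sqrt A, which is affine in x, so convexity is the
  triangle inequality.\<close>

lemma convex_on_excess:
  assumes "A \<ge> 0" shows "convex_on UNIV (excess A)"
proof (rule convex_onI)
  fix t x y :: real
  assume t: "0 < t" "t < 1"
  let ?z = "\<lambda>x. Complex x (sqrt A)"
  have n: "cmod (?z x) = sqrt (A + x\<^sup>2)" for x
    using assms by (simp add: cmod_def add.commute)
  have "?z ((1 - t) * x + t * y) = of_real (1 - t) * ?z x + of_real t * ?z y"
    by (simp add: complex_eq_iff algebra_simps)
  then have "cmod (?z ((1 - t) * x + t * y)) \<le> (1 - t) * cmod (?z x) + t * cmod (?z y)"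
    using t by (metis abs_of_pos diff_gt_0_iff_gt norm_mult norm_of_real norm_triangle_ineq)
  then show "excess A ((1 - t) *\<^sub>R x + t *\<^sub>R y) \<le> (1 - t) * excess A x + t * excess A y"
    unfolding n by (simp add: excess_def algebra_simps)
qed auto

lemma ennreal_sqrt_add_le:
  assumes "\<epsilon> \<ge> 0" "x \<ge> 0" shows "ennreal (sqrt (\<epsilon> + x)) \<le> ennreal (sqrt \<epsilon>) + ennreal (sqrt x)"
  using assms sqrt_add_le_add_sqrt[of \<epsilon> x] by (subst ennreal_plus[symmetric]) (auto intro: ennreal_leI simp del: ennreal_plus)

section \<open>A Bernstein inequality with Fejer weights\<close>

text \<open>Orthogonality of characters, by the geometric series. The bound on \<open>q\<close>
  excludes aliasing: 0 is the only multiple of \<open>M\<close> in that range.\<close>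

lemma sum_cis_roots:
  fixes q :: int
  assumes "M > 0" "\<bar>q\<bar> < int M"
  shows "(\<Sum>j<M. cis (of_int q * (2*pi*real j/real M))) = (if q = 0 then of_nat M else 0)"
proof (cases "q = 0")
  case False
  define z where "z = cis (of_int q * (2*pi/real M))"
  have z: "cis (of_int q * (2*pi*real j/real M)) = z ^ j" for j
    unfolding z_def Complex.DeMoivre by (simp add: field_simps)
  have zM: "z ^ M = 1"
  proof -
    have "z ^ M = cis (2 * pi * of_int q)"
      using assms(1) by (simp add: z_def Complex.DeMoivre mult_ac)
    then show ?thesis by (simp add: cis_multiple_2pi)
  qed
  have "z \<noteq> 1"
  proof
    assume "z = 1"
    then have "cos (of_int q * (2*pi/real M)) = 1"
      by (simp add: z_def complex_eq_iff)
    then obtain n :: int where "of_int q * (2*pi/real M) = of_int n * 2 * pi"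
      unfolding cos_one_2pi_int by auto
    then have "real_of_int q = of_int n * real M"
      using assms(1) by (simp add: field_simps)
    then have "q = n * int M"
      by (metis of_int_eq_iff of_int_mult of_int_of_nat_eq)
    with assms(2) False show False by (simp add: abs_mult)
  qed
  then show ?thesis using False zM
    by (simp only: z) (simp add: geometric_sum)
qed (use assms in simp)

text \<open>The points of a d by d square on a shifted diagonal. Their number, a triangle in
  \<open>q\<close>, gives the Fourier coefficients of the Fejer kernel.\<close>

lemma card_diagonal:
  fixes d :: nat and q :: int
  shows "card {(k,l). k < d \<and> l < d \<and> int k - int l + q = 0} = nat (int d - \<bar>q\<bar>)"
proof (cases "q \<ge> 0")
  case True
  have "{(k,l). k < d \<and> l < d \<and> int k - int l + q = 0} = (\<lambda>k. (k, k + nat q)) ` {..<d - nat q}"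
    using True by (auto simp: image_iff)
  moreover have "inj_on (\<lambda>k. (k, k + nat q)) {..<d - nat q}" by (auto intro: inj_onI)
  ultimately show ?thesis using True by (simp add: card_image nat_diff_distrib')
next
  case False
  have "{(k,l). k < d \<and> l < d \<and> int k - int l + q = 0} = (\<lambda>l. (l + nat (-q), l)) ` {..<d - nat (-q)}"
    using False by (auto simp: image_iff)
  moreover have "inj_on (\<lambda>l. (l + nat (-q), l)) {..<d - nat (-q)}" by (auto intro: inj_onI)
  ultimately show ?thesis using False by (simp add: card_image nat_diff_distrib')
qed

text \<open>With 4 d nodes all frequencies k - l + q that occur below, of modulus at most (d - 1) +
  2 d, are resolved without aliasing.\<close>

definition fejer_node :: "nat \<Rightarrow> nat \<Rightarrow> real" where
  "fejer_node d j = 2 * pi * real j / real (4 * d)"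

text \<open>The squared modulus divided by d is the Fejer kernel at the node; the factor 4 d
  averages over the nodes.\<close>

definition fejer_weight :: "nat \<Rightarrow> nat \<Rightarrow> real" where
  "fejer_weight d j = (cmod (\<Sum>k<d. cis (real k * fejer_node d j)))\<^sup>2 / (real d * real (4 * d))"

lemma fejer_weight_nonneg: "fejer_weight d j \<ge> 0"
  by (simp add: fejer_weight_def)

text \<open>Expanding the square gives a double sum of characters of frequency k - l + q. By
  orthogonality only the pairs with k - l + q = 0 survive, and \<open>card_diagonal\<close> counts
  them.\<close>

lemma fejer_weight_transform:
  fixes q :: int
  assumes d: "d > 0" and q: "\<bar>q\<bar> \<le> 2 * int d"
  shows "(\<Sum>j<4*d. of_real (fejer_weight d j) * cis (of_int q * fejer_node d j))
       = of_real (of_int (max 0 (int d - \<bar>q\<bar>)) / real d)"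
proof -
  let ?x = "fejer_node d"
  have sq: "of_real ((cmod (\<Sum>k<d. cis (real k * ?x j)))\<^sup>2)
      = (\<Sum>(k,l)\<in>{..<d}\<times>{..<d}. cis (of_int (int k - int l) * ?x j))" for j
    by (simp only: complex_norm_square cnj_sum sum_product sum.cartesian_product)
       (simp add: cis_cnj cis_mult algebra_simps)
  have inner: "(\<Sum>j<4*d. cis (of_int (int k - int l + q) * ?x j))
      = (if int k - int l + q = 0 then of_nat (4*d) else 0)" if "k < d" "l < d" for k l
    unfolding fejer_node_def
    by (rule sum_cis_roots) (use that d q in auto)
  have "(\<Sum>j<4*d. of_real (fejer_weight d j) * cis (of_int q * ?x j))
      = (\<Sum>j<4*d. (\<Sum>(k,l)\<in>{..<d}\<times>{..<d}. cis (of_int (int k - int l + q) * ?x j)))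
          / of_real (real d * real (4 * d))"
    unfolding fejer_weight_def of_real_divide sq sum_divide_distrib
    by (intro sum.cong refl)
       (simp add: sum_distrib_right sum_distrib_left sum_divide_distrib case_prod_unfold cis_mult algebra_simps)
  also have "(\<Sum>j<4*d. (\<Sum>(k,l)\<in>{..<d}\<times>{..<d}. cis (of_int (int k - int l + q) * ?x j)))
      = (\<Sum>(k,l)\<in>{..<d}\<times>{..<d}. if int k - int l + q = 0 then of_nat (4*d) else 0)"
    by (subst sum.swap) (intro sum.cong refl, use inner in auto)
  also have "\<dots> = of_nat (4*d) * of_nat (card {(k,l). k < d \<and> l < d \<and> int k - int l + q = 0})"
  proof -
    have "{p \<in> {..<d}\<times>{..<d}. int (fst p) - int (snd p) + q = 0} = {(k,l). k < d \<and> l < d \<and> int k - int l + q = 0}"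
      by auto
    then show ?thesis
      by (simp add: case_prod_unfold sum.If_cases Int_def)
  qed
  also have "\<dots> / of_real (real d * real (4 * d)) = of_real (of_int (max 0 (int d - \<bar>q\<bar>)) / real d)"
  proof -
    have "real (nat (int d - \<bar>q\<bar>)) = of_int (max 0 (int d - \<bar>q\<bar>))" by simp
    then have "(of_nat (nat (int d - \<bar>q\<bar>)) :: complex) = of_real (of_int (max 0 (int d - \<bar>q\<bar>)))"
      by (metis of_real_of_nat_eq)
    then show ?thesis using d unfolding card_diagonal by (simp add: field_simps)
  qed
  finally show ?thesis .
qed

lemma sum_fejer_weight:
  assumes "d > 0" shows "(\<Sum>j<4*d. fejer_weight d j) = 1"
proof -
  have "complex_of_real (\<Sum>j<4*d. fejer_weight d j) = 1"
    using fejer_weight_transform[OF assms, of 0] assms by simp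
  then show ?thesis using of_real_eq_1_iff by blast
qed

lemma trig_poly_cis:
  assumes "trig_poly_deg_le f d"
  obtains c where "\<And>t. f t = (\<Sum>n\<in>{-int d..int d}. c n * cis (of_int n * t))"
  using assms unfolding trig_poly_deg_le_def
  by (metis (no_types, lifting) cis_conv_exp mult.assoc of_real_mult of_real_of_int_eq sum.cong)

text \<open>On frequencies of modulus at most \<open>d\<close> the multiplier \<open>n / d\<close> is the difference of the two
  triangles of half-width \<open>d\<close> centred at \<open>d\<close> and \<open>-d\<close>, that is, the transform of the Fejer kernel
  times \<open>2 i sin (d x)\<close>. Sampling this kernel at \<open>4d\<close> equidistant nodes loses nothing.\<close>

lemma trig_poly_derivative:
  assumes f: "trig_poly_deg_le f d" and d: "d > 0"
  obtains f' where "\<And>t. (f has_vector_derivative f' t) (at t)" "continuous_on UNIV f'"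
    "\<And>u. cmod (f' u) \<le> 2 * real d * (\<Sum>j<4*d. fejer_weight d j * cmod (f (u - fejer_node d j)))"
proof -
  obtain c where c: "\<And>t. f t = (\<Sum>n\<in>{-int d..int d}. c n * cis (of_int n * t))"
    using trig_poly_cis[OF f] by blast
  define f' where "f' t = (\<Sum>n\<in>{-int d..int d}. c n * (\<i> * of_int n * cis (of_int n * t)))" for t
  let ?x = "fejer_node d" and ?w = "fejer_weight d"
  have der: "(f has_vector_derivative f' t) (at t)" for t
  proof -
    have "f = (\<lambda>t. \<Sum>n\<in>{-int d..int d}. c n * exp (\<i> * of_int n * of_real t))"
      by (rule ext) (simp add: c cis_conv_exp mult.assoc)
    moreover have "((\<lambda>t. \<Sum>n\<in>{-int d..int d}. c n * exp (\<i> * of_int n * of_real t))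
        has_vector_derivative f' t) (at t)"
      unfolding f'_def
      by (auto intro!: derivative_eq_intros has_vector_derivative_real_field simp: cis_conv_exp mult_ac)
    ultimately show ?thesis by simp
  qed
  have cont: "continuous_on UNIV f'"
    unfolding f'_def cis_conv_exp by (intro continuous_intros)
  have mult: "(\<Sum>j<4*d. of_real (?w j) * (cis (real d * ?x j) - cis (- real d * ?x j)) * cis (- of_int n * ?x j))
      = of_int n / of_nat d" if n: "n \<in> {-int d..int d}" for n
  proof -
    have "(\<Sum>j<4*d. of_real (?w j) * (cis (real d * ?x j) - cis (- real d * ?x j)) * cis (- of_int n * ?x j))
      = (\<Sum>j<4*d. of_real (?w j) * cis (of_int (int d - n) * ?x j))
        - (\<Sum>j<4*d. of_real (?w j) * cis (of_int (- int d - n) * ?x j))"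
      unfolding sum_subtractf[symmetric]
      by (intro sum.cong refl) (simp add: algebra_simps cis_mult minus_diff_commute)
    also have "\<dots> = of_real (of_int (max 0 (int d - \<bar>int d - n\<bar>)) / real d)
        - of_real (of_int (max 0 (int d - \<bar>- int d - n\<bar>)) / real d)"
      using n d by (subst (1 2) fejer_weight_transform) auto
    also have "\<dots> = of_real (of_int (max 0 (int d - \<bar>int d - n\<bar>) - max 0 (int d - \<bar>- int d - n\<bar>)) / real d)"
      by (simp only: of_real_diff[symmetric] of_int_diff diff_divide_distrib)
    \<comment> \<open>For n \<ge> 0 the first triangle equals n and the second vanishes; for n < 0
      the first vanishes and the second equals -n.\<close>
    also have "max 0 (int d - \<bar>int d - n\<bar>) - max 0 (int d - \<bar>- int d - n\<bar>) = n"
      using n by (auto simp: max_def)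
    finally show ?thesis by simp
  qed
  \<comment> \<open>Differentiation multiplies the coefficient at n by i n = i d (n / d), and n / d
    is the multiplier just computed.\<close>
  have rep: "f' u = \<i> * of_nat d * (\<Sum>j<4*d. of_real (?w j) * (cis (real d * ?x j) - cis (- real d * ?x j)) * f (u - ?x j))" for u
  proof -
    have "(\<Sum>j<4*d. of_real (?w j) * (cis (real d * ?x j) - cis (- real d * ?x j)) * f (u - ?x j))
       = (\<Sum>j<4*d. \<Sum>n\<in>{-int d..int d}. c n * cis (of_int n * u) *
           (of_real (?w j) * (cis (real d * ?x j) - cis (- real d * ?x j)) * cis (- of_int n * ?x j)))"
      unfolding c sum_distrib_left
    proof (intro sum.cong refl)
      fix j n
      have "cis (of_int n * (u - ?x j)) = cis (of_int n * u) * cis (- of_int n * ?x j)"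
        unfolding cis_mult by (simp add: algebra_simps)
      then show "of_real (?w j) * (cis (real d * ?x j) - cis (- real d * ?x j)) * (c n * cis (of_int n * (u - ?x j)))
         = c n * cis (of_int n * u) *
           (of_real (?w j) * (cis (real d * ?x j) - cis (- real d * ?x j)) * cis (- of_int n * ?x j))"
        by (simp only: mult_ac)
    qed
    also have "\<dots> = (\<Sum>n\<in>{-int d..int d}. c n * cis (of_int n * u) * (of_int n / of_nat d))"
      by (subst sum.swap) (simp only: sum_distrib_left[symmetric] mult cong: sum.cong)
    finally show ?thesis
      using d by (simp add: f'_def sum_distrib_left field_simps)
  qed
  have bd: "cmod (f' u) \<le> 2 * real d * (\<Sum>j<4*d. ?w j * cmod (f (u - ?x j)))" for u
  proof -
    have "cmod (\<Sum>j<4*d. of_real (?w j) * (cis (real d * ?x j) - cis (- real d * ?x j)) * f (u - ?x j))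
      \<le> (\<Sum>j<4*d. ?w j * 2 * cmod (f (u - ?x j)))"
    proof (rule sum_norm_le)
      fix j
      have "cmod (cis (real d * ?x j) - cis (- real d * ?x j)) \<le> 2"
        using norm_triangle_ineq4[of "cis (real d * ?x j)" "cis (- real d * ?x j)"] by simp
      then show "cmod (of_real (?w j) * (cis (real d * ?x j) - cis (- real d * ?x j)) * f (u - ?x j))
         \<le> ?w j * 2 * cmod (f (u - ?x j))"
        unfolding norm_mult norm_of_real using fejer_weight_nonneg[of d j]
        by (intro mult_mono) auto
    qed
    then have "cmod (f' u) \<le> real d * (\<Sum>j<4*d. ?w j * 2 * cmod (f (u - ?x j)))"
      unfolding rep norm_mult by (auto intro!: mult_left_mono)
    then show ?thesis by (simp add: sum_distrib_left mult_ac)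
  qed
  from der cont bd show thesis by (rule that)
qed

lemma trig_poly_continuous:
  assumes "trig_poly_deg_le f d" shows "continuous_on UNIV f"
proof -
  obtain c where "\<And>t. f t = (\<Sum>n\<in>{-int d..int d}. c n * cis (of_int n * t))"
    using trig_poly_cis[OF assms] by blast
  then have "f = (\<lambda>t. \<Sum>n\<in>{-int d..int d}. c n * cis (of_int n * t))" by blast
  then show ?thesis by (simp only: cis_conv_exp) (intro continuous_intros)
qed

lemma trig_poly_periodic:
  assumes "trig_poly_deg_le f d" shows "f (t + 2 * pi) = f t"
proof -
  obtain c where c: "\<And>t. f t = (\<Sum>n\<in>{-int d..int d}. c n * cis (of_int n * t))"
    using trig_poly_cis[OF assms] by blast
  have "cis (of_int n * (t + 2*pi)) = cis (of_int n * t)" for n :: int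
  proof -
    have "cis (of_int n * (t + 2*pi)) = cis (of_int n * t) * cis (2 * pi * of_int n)"
      unfolding cis_mult by (simp add: algebra_simps)
    then show ?thesis by simp
  qed
  then show ?thesis by (simp add: c)
qed

lemma trig_poly_bounded:
  assumes "trig_poly_deg_le f d"
  obtains B where "\<And>t. cmod (f t) \<le> B"
proof -
  obtain c where c: "\<And>t. f t = (\<Sum>n\<in>{-int d..int d}. c n * cis (of_int n * t))"
    using trig_poly_cis[OF assms] by blast
  show thesis
    by (rule that[of "\<Sum>n\<in>{-int d..int d}. cmod (c n)"])
       (auto simp: c norm_mult intro!: sum_norm_le)
qed

section \<open>Averages over the torus\<close>

lemma prob_space_torus: "prob_space torus_measure"
  unfolding torus_measure_def by (rule prob_space_uniform_measure) auto

lemma sets_torus [simp, measurable_cong]: "sets torus_measure = sets borel"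
  by (simp add: torus_measure_def)

lemma space_torus [simp]: "space torus_measure = UNIV"
  by (simp add: torus_measure_def)

lemma emeasure_torus_UNIV [simp]: "emeasure torus_measure UNIV = 1"
  using prob_space.emeasure_space_1[OF prob_space_torus] by simp

lemma sigma_finite_torus: "sigma_finite_measure torus_measure"
  using prob_space_torus by (simp add: prob_space_imp_sigma_finite)

lemma nn_integral_torus:
  assumes [measurable]: "g \<in> borel_measurable borel"
  shows "(\<integral>\<^sup>+u. g u \<partial>torus_measure) = (\<integral>\<^sup>+u. g u * indicator {0..<2*pi} u \<partial>lborel) / ennreal (2*pi)"
  unfolding torus_measure_def by (subst nn_integral_uniform_measure) auto

lemma periodic_int_shift:
  fixes g :: "real \<Rightarrow> 'a"
  assumes "\<And>t. g (t + p) = g t"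
  shows "g (t + of_int k * p) = g t"
proof -
  have nat: "g (t + real n * p) = g t" for n t
  proof (induction n)
    case (Suc n)
    have "g (t + real (Suc n) * p) = g ((t + real n * p) + p)" by (simp add: algebra_simps)
    with Suc assms show ?case by simp
  qed simp
  show ?thesis
  proof (cases "k \<ge> 0")
    case True
    then show ?thesis using nat[of t "nat k"] by simp
  next
    case False
    then show ?thesis using nat[of "t + of_int k * p" "nat (- k)"] by simp
  qed
qed

text \<open>Periodicity reduces the shift to some \<open>r\<close> in [0, 2 pi). The shifted window
  [r, 2 pi + r) is cut at 2 pi, and the overhanging piece is moved back by one period.\<close>

lemma nn_integral_torus_translate:
  fixes g :: "real \<Rightarrow> ennreal"
  assumes [measurable]: "g \<in> borel_measurable borel" and per: "\<And>t. g (t + 2*pi) = g t"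
  shows "(\<integral>\<^sup>+u. g (u + s) \<partial>torus_measure) = (\<integral>\<^sup>+u. g u \<partial>torus_measure)"
proof -
  define r where "r = s - of_int \<lfloor>s / (2*pi)\<rfloor> * (2*pi)"
  have r: "0 \<le> r" "r < 2*pi"
    using floor_divide_lower[of "2*pi" s] floor_divide_upper[of "2*pi" s]
    by (auto simp: r_def algebra_simps)
  have gs: "g (u + s) = g (u + r)" for u
    using periodic_int_shift[of g, OF per, of "u + r" "\<lfloor>s / (2*pi)\<rfloor>"] by (simp add: r_def algebra_simps)
  have "(\<integral>\<^sup>+u. g (u + r) * indicator {0..<2*pi} u \<partial>lborel)
      = (\<integral>\<^sup>+u. g u * indicator {r..<2*pi+r} u \<partial>lborel)"
    by (subst (2) nn_integral_real_affine[where c=1 and t=r])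
       (auto intro!: nn_integral_cong simp: indicator_def add.commute)
  also have "\<dots> = (\<integral>\<^sup>+u. g u * indicator {r..<2*pi} u + g u * indicator {2*pi..<2*pi+r} u \<partial>lborel)"
    using r by (intro nn_integral_cong) (auto simp: indicator_def)
  also have "\<dots> = (\<integral>\<^sup>+u. g u * indicator {r..<2*pi} u \<partial>lborel) + (\<integral>\<^sup>+u. g u * indicator {2*pi..<2*pi+r} u \<partial>lborel)"
    by (rule nn_integral_add) auto
  also have "(\<integral>\<^sup>+u. g u * indicator {2*pi..<2*pi+r} u \<partial>lborel) = (\<integral>\<^sup>+u. g u * indicator {0..<r} u \<partial>lborel)"
    by (subst nn_integral_real_affine[where c=1 and t="2*pi"])
       (auto intro!: nn_integral_cong simp: indicator_def per add.commute[of "2*pi"])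
  also have "(\<integral>\<^sup>+u. g u * indicator {r..<2*pi} u \<partial>lborel) + (\<integral>\<^sup>+u. g u * indicator {0..<r} u \<partial>lborel)
      = (\<integral>\<^sup>+u. g u * indicator {r..<2*pi} u + g u * indicator {0..<r} u \<partial>lborel)"
    by (rule nn_integral_add[symmetric]) auto
  also have "\<dots> = (\<integral>\<^sup>+u. g u * indicator {0..<2*pi} u \<partial>lborel)"
    using r by (intro nn_integral_cong) (auto simp: indicator_def)
  finally show ?thesis
    unfolding gs by (subst (1 2) nn_integral_torus) auto
qed

text \<open>Nothing is assumed about the regularity of \<open>g'\<close>, so the continuous majorant
  \<open>b\<close> is integrated instead: with a primitive \<open>P\<close> of \<open>b\<close>,
  both P - g and P + g are nondecreasing.\<close>

lemma abs_diff_le_nn_integral: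
  fixes g b :: "real \<Rightarrow> real"
  assumes der: "\<And>v. (g has_real_derivative g' v) (at v)" and bd: "\<And>v. \<bar>g' v\<bar> \<le> b v"
    and cont: "continuous_on UNIV b" and "x \<le> y"
  shows "ennreal \<bar>g y - g x\<bar> \<le> (\<integral>\<^sup>+v. ennreal (b v) * indicator {x..y} v \<partial>lborel)"
proof -
  have b0: "0 \<le> b v" for v using bd[of v] by linarith
  \<comment> \<open>Starting at \<open>x - 1\<close> makes \<open>x\<close> an interior point of the
    interval used below, so that \<open>P\<close> has a two-sided derivative there.\<close>
  define P where "P v = integral {x-1..v} b" for v
  have P: "(P has_real_derivative b v) (at v)" if "v \<in> {x..y}" for v
  proof -
    have "(P has_real_derivative b v) (at v within {x-1..y+1})"
      unfolding P_def
      by (rule integral_has_real_derivative[OF continuous_on_subset[OF cont]]) (use that in auto)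
    then show ?thesis using that by (simp add: at_within_Icc_at)
  qed
  have nn: "(\<integral>\<^sup>+v. ennreal (b v) * indicator {x..y} v \<partial>lborel) = ennreal (P y - P x)"
    by (rule nn_integral_FTC_Icc)
       (use P b0 \<open>x \<le> y\<close> cont in \<open>auto intro!: borel_measurable_continuous_onI\<close>)
  have mono: "h x \<le> h y" if "\<And>v. v \<in> {x..y} \<Longrightarrow> (h has_real_derivative h' v) (at v)"
    and "\<And>v. 0 \<le> h' v" for h h' :: "real \<Rightarrow> real"
    by (rule DERIV_nonneg_imp_nondecreasing[OF \<open>x \<le> y\<close>]) (use that in auto)
  have 1: "P x - g x \<le> P y - g y"
    by (rule mono[of "\<lambda>v. P v - g v" "\<lambda>v. b v - g' v"])
       (auto intro!: derivative_intros P der simp: abs_le_D1[OF bd])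
  have 2: "P x + g x \<le> P y + g y"
  proof (rule mono[of "\<lambda>v. P v + g v" "\<lambda>v. b v + g' v"])
    fix v show "0 \<le> b v + g' v" using bd[of v] by linarith
  qed (auto intro!: derivative_intros P der)
  show ?thesis unfolding nn using 1 2 by (intro ennreal_leI) auto
qed

section \<open>Translating and decoupling one function\<close>

lemma measurable_excess [measurable]:
  assumes [measurable]: "g \<in> borel_measurable M"
  shows "(\<lambda>x. excess A (g x)) \<in> borel_measurable M"
  unfolding excess_def by measurable

text \<open>Jensen's inequality for the Fejer average, followed by translation invariance.\<close>

lemma nn_integral_excess_derivative:
  assumes f: "trig_poly_deg_le f d" and d: "d > 0" and A: "A > 0"
    and bd: "\<And>u. cmod (f' u) \<le> 2 * real d * (\<Sum>j<4*d. fejer_weight d j * cmod (f (u - fejer_node d j)))"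
  shows "(\<integral>\<^sup>+u. ennreal (excess A (cmod (f' u) / (2 * real d))) \<partial>torus_measure)
       \<le> (\<integral>\<^sup>+u. ennreal (excess A (cmod (f u))) \<partial>torus_measure)"
proof -
  have [measurable]: "f \<in> borel_measurable borel"
    using trig_poly_continuous[OF f] by (rule borel_measurable_continuous_onI)
  let ?D = "\<integral>\<^sup>+u. ennreal (excess A (cmod (f u))) \<partial>torus_measure"
  have "excess A (cmod (f' u) / (2 * real d))
      \<le> (\<Sum>j<4*d. fejer_weight d j * excess A (cmod (f (u - fejer_node d j))))" for u
  proof -
    have "excess A (cmod (f' u) / (2 * real d)) \<le> excess A (\<Sum>j<4*d. fejer_weight d j *\<^sub>R cmod (f (u - fejer_node d j)))"
      using bd[of u] d by (intro excess_mono) (auto simp: field_simps)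
    also have "\<dots> \<le> (\<Sum>j<4*d. fejer_weight d j * excess A (cmod (f (u - fejer_node d j))))"
      using d A by (intro convex_on_sum[OF _ _ convex_on_excess])
        (auto simp: sum_fejer_weight fejer_weight_nonneg lessThan_empty_iff)
    finally show ?thesis .
  qed
  then have "(\<integral>\<^sup>+u. ennreal (excess A (cmod (f' u) / (2 * real d))) \<partial>torus_measure)
      \<le> (\<integral>\<^sup>+u. ennreal (\<Sum>j<4*d. fejer_weight d j * excess A (cmod (f (u - fejer_node d j)))) \<partial>torus_measure)"
    by (intro nn_integral_mono ennreal_leI)
  also have "\<dots> = (\<integral>\<^sup>+u. (\<Sum>j<4*d. ennreal (fejer_weight d j) * ennreal (excess A (cmod (f (u - fejer_node d j))))) \<partial>torus_measure)"
    by (simp add: sum_ennreal[symmetric] ennreal_mult fejer_weight_nonneg excess_nonneg del: sum_ennreal)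
  also have "\<dots> = (\<Sum>j<4*d. ennreal (fejer_weight d j) * (\<integral>\<^sup>+u. ennreal (excess A (cmod (f (u - fejer_node d j)))) \<partial>torus_measure))"
    by (simp add: nn_integral_sum nn_integral_cmult)
  also have "\<dots> = (\<Sum>j<4*d. ennreal (fejer_weight d j) * ?D)"
  proof (intro sum.cong refl arg_cong2[where f="(*)"])
    fix j
    show "(\<integral>\<^sup>+u. ennreal (excess A (cmod (f (u - fejer_node d j)))) \<partial>torus_measure) = ?D"
      using nn_integral_torus_translate[of "\<lambda>u. ennreal (excess A (cmod (f u)))" "- fejer_node d j"]
      by (simp add: trig_poly_periodic[OF f])
  qed
  also have "\<dots> = ennreal (\<Sum>j<4*d. fejer_weight d j) * ?D"
    by (simp add: sum_ennreal[symmetric] sum_distrib_right fejer_weight_nonneg del: sum_ennreal)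
  also have "\<dots> = ?D" using d by (simp add: sum_fejer_weight)
  finally show ?thesis .
qed

lemma Fubini_torus_lborel:
  assumes "(\<lambda>(u, w). F u w) \<in> borel_measurable (torus_measure \<Otimes>\<^sub>M lborel)"
  shows "(\<integral>\<^sup>+u. \<integral>\<^sup>+w. F u w \<partial>lborel \<partial>torus_measure) = (\<integral>\<^sup>+w. \<integral>\<^sup>+u. F u w \<partial>torus_measure \<partial>lborel)"
proof -
  interpret T: sigma_finite_measure torus_measure by (rule sigma_finite_torus)
  interpret pair_sigma_finite torus_measure lborel ..
  show ?thesis using Fubini'[OF assms] by simp
qed

lemma Fubini_torus_torus:
  assumes "(\<lambda>(u, w). F u w) \<in> borel_measurable (torus_measure \<Otimes>\<^sub>M torus_measure)"
  shows "(\<integral>\<^sup>+u. \<integral>\<^sup>+w. F u w \<partial>torus_measure \<partial>torus_measure) = (\<integral>\<^sup>+w. \<integral>\<^sup>+u. F u w \<partial>torus_measure \<partial>torus_measure)"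
proof -
  interpret T: sigma_finite_measure torus_measure by (rule sigma_finite_torus)
  interpret pair_sigma_finite torus_measure torus_measure ..
  show ?thesis using Fubini'[OF assms] by simp
qed

text \<open>The change over [u - \<sigma>, u] is at most the integral of a majorant \<open>b\<close>
  of the derivative. Averaging over u, Fubini and translation invariance give \<sigma> times the
  mean of \<open>b\<close>, which is at most 8 d times the mean excess, because Jensen's inequality
  bounds the part with f' by the part with f.\<close>

lemma nn_integral_sqrt_translate:
  assumes f: "trig_poly_deg_le f d" and d: "d > 0" and A: "A > 0" and \<sigma>: "\<sigma> \<ge> 0"
  shows "(\<integral>\<^sup>+u. ennreal \<bar>sqrt (A + (cmod (f u))\<^sup>2) - sqrt (A + (cmod (f (u - \<sigma>)))\<^sup>2)\<bar> \<partial>torus_measure)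
       \<le> ennreal (8 * real d * \<sigma>) * (\<integral>\<^sup>+u. ennreal (excess A (cmod (f u))) \<partial>torus_measure)"
proof -
  obtain f' where der: "\<And>t. (f has_vector_derivative f' t) (at t)" and cont': "continuous_on UNIV f'"
    and bd: "\<And>u. cmod (f' u) \<le> 2 * real d * (\<Sum>j<4*d. fejer_weight d j * cmod (f (u - fejer_node d j)))"
    using trig_poly_derivative[OF f d] by blast
  note cont = trig_poly_continuous[OF f]
  have per: "f (t + 2*pi) = f t" for t by (rule trig_poly_periodic[OF f])
  \<comment> \<open>Translation invariance is going to be applied to a function containing f';
    uniqueness of derivatives hands the period of f on to it.\<close>
  have per': "f' (t + 2*pi) = f' t" for t
  proof -
    have "((\<lambda>t. t + 2*pi) has_vector_derivative 1) (at t)"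
      by (auto intro!: derivative_eq_intros)
    then have "((\<lambda>t. f (t + 2*pi)) has_vector_derivative f' (t + 2*pi)) (at t)"
      using vector_diff_chain_at[of "\<lambda>t. t + 2*pi" 1 t f "f' (t + 2*pi)"] der
      by (simp add: o_def)
    then show ?thesis unfolding per using der vector_derivative_unique_at by blast
  qed
  have [measurable]: "f \<in> borel_measurable borel" "f' \<in> borel_measurable borel"
    using cont cont' by (auto intro: borel_measurable_continuous_onI)
  let ?D = "\<integral>\<^sup>+u. ennreal (excess A (cmod (f u))) \<partial>torus_measure"
  define g where "g v = sqrt (A + (cmod (f v))\<^sup>2)" for v
  \<comment> \<open>The derivative is at most |f| |f'| / g = 2 d (|f'| / (2 d)) |f| / g, and
    \<open>mult_le_excess\<close> contributes another factor 2. The scaling by 2 d makes |f'| / (2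
    d) at most a Fejer average of |f|.\<close>
  define b where "b v = 4 * real d * (excess A (cmod (f' v) / (2 * real d)) + excess A (cmod (f v)))" for v
  have b0: "b v \<ge> 0" for v by (simp add: b_def excess_nonneg)
  have cb: "continuous_on UNIV b"
    unfolding b_def by (intro continuous_intros cont cont') (use d in auto)
  have [measurable]: "b \<in> borel_measurable borel"
    using cb by (rule borel_measurable_continuous_onI)
  \<comment> \<open>Positivity of \<open>A\<close> keeps the root differentiable at the zeros of
    f.\<close>
  have dg: "(g has_real_derivative (2 * (f v \<bullet> f' v)) / (2 * g v)) (at v)" for v
  proof -
    have "((\<lambda>v. f v \<bullet> f v) has_vector_derivative (f v \<bullet> f' v + f' v \<bullet> f v)) (at v)"
      by (rule bounded_bilinear.has_vector_derivative[OF bounded_bilinear_inner der der])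
    then have "((\<lambda>v. (cmod (f v))\<^sup>2) has_real_derivative 2 * (f v \<bullet> f' v)) (at v)"
      by (simp add: power2_norm_eq_inner inner_commute has_real_derivative_iff_has_vector_derivative)
    then have "((\<lambda>v. sqrt (A + (cmod (f v))\<^sup>2)) has_real_derivative
        inverse (sqrt (A + (cmod (f v))\<^sup>2)) / 2 * (0 + 2 * (f v \<bullet> f' v))) (at v)"
      by (rule DERIV_chain2[OF DERIV_real_sqrt DERIV_add[OF DERIV_const], rotated])
         (use A in \<open>simp add: add_pos_nonneg\<close>)
    then show ?thesis by (simp add: g_def[abs_def] field_simps)
  qed
  have bg: "\<bar>(2 * (f v \<bullet> f' v)) / (2 * g v)\<bar> \<le> b v" for v
  proof -
    have g0: "g v > 0" using A by (simp add: g_def add_pos_nonneg)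
    have "\<bar>f v \<bullet> f' v\<bar> / g v \<le> cmod (f v) * cmod (f' v) / g v"
      using g0 Cauchy_Schwarz_ineq2[of "f v" "f' v"] by (intro divide_right_mono) auto
    also have "\<dots> = 2 * real d * ((cmod (f' v) / (2 * real d)) * cmod (f v) / g v)"
      using d by (simp add: field_simps)
    also have "\<dots> \<le> 2 * real d * (2 * (excess A (cmod (f' v) / (2 * real d)) + excess A (cmod (f v))))"
      unfolding g_def by (intro mult_left_mono mult_le_excess A) auto
    finally show ?thesis using g0 by (simp add: b_def abs_mult algebra_simps)
  qed
  have "(\<integral>\<^sup>+u. ennreal \<bar>g u - g (u - \<sigma>)\<bar> \<partial>torus_measure)
      \<le> (\<integral>\<^sup>+u. \<integral>\<^sup>+v. ennreal (b v) * indicator {u - \<sigma>..u} v \<partial>lborel \<partial>torus_measure)"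
    using \<sigma> by (intro nn_integral_mono abs_diff_le_nn_integral[OF dg bg cb]) auto
  \<comment> \<open>Substituting v = u + w makes the window of integration independent of u, as
    needed to exchange the integrals.\<close>
  also have "\<dots> = (\<integral>\<^sup>+u. \<integral>\<^sup>+w. ennreal (b (u + w)) * indicator {-\<sigma>..0} w \<partial>lborel \<partial>torus_measure)"
  proof (rule nn_integral_cong)
    fix u
    show "(\<integral>\<^sup>+v. ennreal (b v) * indicator {u - \<sigma>..u} v \<partial>lborel) = (\<integral>\<^sup>+w. ennreal (b (u + w)) * indicator {-\<sigma>..0} w \<partial>lborel)"
      by (subst nn_integral_real_affine[where c=1 and t=u])
         (auto intro!: nn_integral_cong simp: indicator_def)
  qed
  also have "\<dots> = (\<integral>\<^sup>+w. \<integral>\<^sup>+u. ennreal (b (u + w)) * indicator {-\<sigma>..0} w \<partial>torus_measure \<partial>lborel)"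
    by (rule Fubini_torus_lborel) measurable
  also have "\<dots> = (\<integral>\<^sup>+w. (\<integral>\<^sup>+u. ennreal (b u) \<partial>torus_measure) * indicator {-\<sigma>..0} w \<partial>lborel)"
  proof (rule nn_integral_cong)
    fix w
    have "(\<integral>\<^sup>+u. ennreal (b (u + w)) \<partial>torus_measure) = (\<integral>\<^sup>+u. ennreal (b u) \<partial>torus_measure)"
      by (rule nn_integral_torus_translate[of "\<lambda>u. ennreal (b u)"]) (auto simp: b_def per per')
    then show "(\<integral>\<^sup>+u. ennreal (b (u + w)) * indicator {-\<sigma>..0} w \<partial>torus_measure)
        = (\<integral>\<^sup>+u. ennreal (b u) \<partial>torus_measure) * indicator {-\<sigma>..0} w"
      by (simp add: nn_integral_multc)
  qed
  also have "\<dots> = (\<integral>\<^sup>+u. ennreal (b u) \<partial>torus_measure) * ennreal \<sigma>"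
    using \<sigma> by (subst nn_integral_cmult) auto
  also have "(\<integral>\<^sup>+u. ennreal (b u) \<partial>torus_measure) = ennreal (4 * real d) *
      ((\<integral>\<^sup>+u. ennreal (excess A (cmod (f' u) / (2 * real d))) \<partial>torus_measure) + ?D)"
    unfolding b_def
    by (subst nn_integral_add[symmetric])
       (auto simp: nn_integral_cmult[symmetric] ennreal_plus[symmetric] ennreal_mult excess_nonneg
             simp del: ennreal_plus)
  also have "\<dots> \<le> ennreal (4 * real d) * (?D + ?D)"
    by (intro mult_left_mono add_right_mono nn_integral_excess_derivative[OF f d A bd]) auto
  also have "\<dots> = ennreal (8 * real d) * ?D"
  proof -
    have "?D + ?D = ennreal 2 * ?D" by (simp add: mult_2)
    moreover have "ennreal (8 * real d) = ennreal (4 * real d) * ennreal 2"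
      by (subst ennreal_mult[symmetric]) auto
    ultimately show ?thesis by (simp only: mult.assoc)
  qed
  finally show ?thesis using \<sigma>
    by (simp add: g_def ennreal_mult mult_right_mono mult_ac)
qed

text \<open>Since \<open>S\<close> is \<open>p\<close>-periodic, a shift of \<open>S\<close> by an arbitrary \<open>s\<close> is a shift by
  some \<open>\<sigma> \<in> [0, p)\<close>, which can be moved over to \<open>f\<close>; there it costs little because
  \<open>f\<close> hardly varies at scale \<open>p\<close>.\<close>

lemma decouple_torus:
  fixes S :: "real \<Rightarrow> real"
  assumes f: "trig_poly_deg_le f d" and d: "d > 0" and A: "A > 0" and M: "M > 0"
    and S0: "\<And>t. S t \<ge> 0" and Sm [measurable]: "S \<in> borel_measurable borel"
    and Sp: "\<And>t. S (t + 2 * pi / real M) = S t"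
  defines "E1 \<equiv> \<integral>\<^sup>+t. ennreal (sqrt (A + (cmod (f t))\<^sup>2 + S t)) \<partial>torus_measure"
    and "E2 \<equiv> \<integral>\<^sup>+u. \<integral>\<^sup>+t. ennreal (sqrt (A + (cmod (f u))\<^sup>2 + S t)) \<partial>torus_measure \<partial>torus_measure"
    and "D \<equiv> ennreal (16 * pi * (real d / real M)) * (\<integral>\<^sup>+u. ennreal (excess A (cmod (f u))) \<partial>torus_measure)"
  shows "E1 \<le> E2 + D" "E2 \<le> E1 + D"
proof -
  have [measurable]: "f \<in> borel_measurable borel"
    using trig_poly_continuous[OF f] by (auto intro: borel_measurable_continuous_onI)
  let ?p = "2 * pi / real M"
  have p: "?p > 0" using M by simp
  have per: "f (t + 2*pi) = f t" for t by (rule trig_poly_periodic[OF f])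
  have S2: "S (t + 2*pi) = S t" for t
    using periodic_int_shift[of S ?p, OF Sp, of t "int M"] M by simp
  \<comment> \<open>Here \<open>s\<close> is the offset between the arguments of S and f:
    \<open>E1\<close> is the value at offset 0, and \<open>E2\<close> is the mean over all offsets.
    It therefore suffices to compare each \<open>F s\<close> with \<open>E1\<close>.\<close>
  define F where "F s = (\<integral>\<^sup>+u. ennreal (sqrt (A + (cmod (f u))\<^sup>2 + S (u + s))) \<partial>torus_measure)" for s
  have E2: "E2 = (\<integral>\<^sup>+s. F s \<partial>torus_measure)"
  proof -
    have "(\<integral>\<^sup>+t. ennreal (sqrt (A + (cmod (f u))\<^sup>2 + S t)) \<partial>torus_measure)
        = (\<integral>\<^sup>+s. ennreal (sqrt (A + (cmod (f u))\<^sup>2 + S (u + s))) \<partial>torus_measure)" for u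
      using nn_integral_torus_translate[of "\<lambda>t. ennreal (sqrt (A + (cmod (f u))\<^sup>2 + S t))" u]
      by (simp add: S2 add.commute)
    then show ?thesis unfolding E2_def F_def by (simp, intro Fubini_torus_torus) measurable
  qed
  have F: "F s \<le> E1 + D \<and> E1 \<le> F s + D" for s
  proof -
    define \<sigma> where "\<sigma> = s - of_int \<lfloor>s / ?p\<rfloor> * ?p"
    have \<sigma>: "0 \<le> \<sigma>" "\<sigma> \<le> ?p"
      using floor_divide_lower[OF p, of s] floor_divide_upper[OF p, of s]
      by (auto simp: \<sigma>_def algebra_simps)
    have Ss: "S (u + s) = S (u + \<sigma>)" for u
      using periodic_int_shift[of S ?p, OF Sp, of "u + \<sigma>" "\<lfloor>s / ?p\<rfloor>"] by (simp add: \<sigma>_def algebra_simps)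
    have per\<sigma>: "f (t + 2*pi - \<sigma>) = f (t - \<sigma>)" for t
      using per[of "t - \<sigma>"] by (simp add: algebra_simps)
    \<comment> \<open>A translation of the integration variable by \<sigma> moves the offset from S
      to f.\<close>
    have Fs: "F s = (\<integral>\<^sup>+u. ennreal (sqrt (A + (cmod (f (u - \<sigma>)))\<^sup>2 + S u)) \<partial>torus_measure)"
      using nn_integral_torus_translate[of "\<lambda>u. ennreal (sqrt (A + (cmod (f (u - \<sigma>)))\<^sup>2 + S u))" \<sigma>]
      by (simp add: F_def Ss S2 per\<sigma>)
    let ?e = "\<lambda>u. \<bar>sqrt (A + (cmod (f u))\<^sup>2) - sqrt (A + (cmod (f (u - \<sigma>)))\<^sup>2)\<bar>"
    have "(\<integral>\<^sup>+u. ennreal (?e u) \<partial>torus_measure) \<le> ennreal (8 * real d * \<sigma>) * (\<integral>\<^sup>+u. ennreal (excess A (cmod (f u))) \<partial>torus_measure)"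
      by (rule nn_integral_sqrt_translate[OF f d A \<sigma>(1)])
    also have "\<dots> \<le> D" unfolding D_def
    proof (intro mult_right_mono ennreal_leI)
      \<comment> \<open>The period 2 pi / M bounds \<sigma>, which turns 8 into the final constant
        16 pi.\<close>
      show "8 * real d * \<sigma> \<le> 16 * pi * (real d / real M)"
        using mult_left_mono[OF \<sigma>(2), of "8 * real d"] by (simp add: mult_ac)
    qed auto
    finally have eD: "(\<integral>\<^sup>+u. ennreal (?e u) \<partial>torus_measure) \<le> D" .
    have pt: "\<bar>sqrt (A + (cmod (f u))\<^sup>2 + S u) - sqrt (A + (cmod (f (u - \<sigma>)))\<^sup>2 + S u)\<bar> \<le> ?e u" for u
      by (rule abs_sqrt_diff_add_le) (use A S0 in auto)
    have "F s \<le> (\<integral>\<^sup>+u. ennreal (sqrt (A + (cmod (f u))\<^sup>2 + S u)) + ennreal (?e u) \<partial>torus_measure)"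
      unfolding Fs
    proof (rule nn_integral_mono)
      fix u
      have "sqrt (A + (cmod (f (u - \<sigma>)))\<^sup>2 + S u) \<le> sqrt (A + (cmod (f u))\<^sup>2 + S u) + ?e u"
        using pt[of u] by linarith
      then show "ennreal (sqrt (A + (cmod (f (u - \<sigma>)))\<^sup>2 + S u)) \<le> ennreal (sqrt (A + (cmod (f u))\<^sup>2 + S u)) + ennreal (?e u)"
        using A S0[of u] by (subst ennreal_plus[symmetric]) (auto intro!: ennreal_leI simp del: ennreal_plus)
    qed
    also have "\<dots> = E1 + (\<integral>\<^sup>+u. ennreal (?e u) \<partial>torus_measure)"
      unfolding E1_def by (rule nn_integral_add) measurable
    finally have 1: "F s \<le> E1 + D" using eD by (meson add_left_mono order_trans)
    have "E1 \<le> (\<integral>\<^sup>+u. ennreal (sqrt (A + (cmod (f (u - \<sigma>)))\<^sup>2 + S u)) + ennreal (?e u) \<partial>torus_measure)"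
      unfolding E1_def
    proof (rule nn_integral_mono)
      fix u
      have "sqrt (A + (cmod (f u))\<^sup>2 + S u) \<le> sqrt (A + (cmod (f (u - \<sigma>)))\<^sup>2 + S u) + ?e u"
        using pt[of u] by linarith
      then show "ennreal (sqrt (A + (cmod (f u))\<^sup>2 + S u)) \<le> ennreal (sqrt (A + (cmod (f (u - \<sigma>)))\<^sup>2 + S u)) + ennreal (?e u)"
        using A S0[of u] by (subst ennreal_plus[symmetric]) (auto intro!: ennreal_leI simp del: ennreal_plus)
    qed
    also have "\<dots> = F s + (\<integral>\<^sup>+u. ennreal (?e u) \<partial>torus_measure)"
      unfolding Fs by (rule nn_integral_add) measurable
    finally have 2: "E1 \<le> F s + D" using eD by (meson add_left_mono order_trans)
    from 1 2 show ?thesis by blast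
  qed
  have Fm: "F \<in> borel_measurable torus_measure"
  proof -
    interpret T: sigma_finite_measure torus_measure by (rule sigma_finite_torus)
    show ?thesis unfolding F_def by measurable
  qed
  have "E2 \<le> (\<integral>\<^sup>+s. (E1 + D) \<partial>torus_measure)"
    unfolding E2 using F by (intro nn_integral_mono) auto
  then show "E2 \<le> E1 + D" by simp
  have "E1 = (\<integral>\<^sup>+s. E1 \<partial>torus_measure)" by simp
  also have "\<dots> \<le> (\<integral>\<^sup>+s. F s + D \<partial>torus_measure)"
    using F by (intro nn_integral_mono) auto
  also have "\<dots> = E2 + D" unfolding E2 using Fm by (subst nn_integral_add) auto
  finally show "E1 \<le> E2 + D" .
qed

section \<open>Decoupling all variables\<close>

locale periodic_trig_polys =
  fixes N d :: "nat \<Rightarrow> nat" and f :: "nat \<Rightarrow> real \<Rightarrow> complex"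
  assumes N_pos: "N k > 0" and N_dvd: "N k dvd N (Suc k)" and d_pos: "d k > 0"
    and trig_poly: "trig_poly_deg_le (f k) (d k)"
    and periodic: "f k (t + 2 * pi / real (N k)) = f k t"
begin

abbreviation prodT :: "nat set \<Rightarrow> (nat \<Rightarrow> real) measure" where
  "prodT J \<equiv> PiM J (\<lambda>_. torus_measure)"

sublocale product_prob_space "\<lambda>_::nat. torus_measure" UNIV
proof -
  interpret prob_space torus_measure by (rule prob_space_torus)
  show "product_prob_space (\<lambda>_::nat. torus_measure)" by unfold_locales
qed

lemma prob_space_prodT: "prob_space (prodT J)"
  by (rule prob_space_PiM) (rule prob_space_torus)

lemma measurable_f [measurable]: "f k \<in> borel_measurable borel"
  using trig_poly_continuous[OF trig_poly] by (rule borel_measurable_continuous_onI)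

definition sqsum :: "nat \<Rightarrow> (nat \<Rightarrow> real) \<Rightarrow> real" where
  "sqsum n \<omega> = (\<Sum>k<n. (cmod (f k (\<omega> k)))\<^sup>2)"

lemma sqsum_nonneg: "sqsum n \<omega> \<ge> 0"
  by (simp add: sqsum_def sum_nonneg)

lemma measurable_sqsum:
  assumes "{..<n} \<subseteq> J" shows "sqsum n \<in> borel_measurable (prodT J)"
  unfolding sqsum_def[abs_def]
proof (rule borel_measurable_sum)
  fix k assume "k \<in> {..<n}"
  then have "k \<in> J" using assms by auto
  then show "(\<lambda>\<omega>. (cmod (f k (\<omega> k)))\<^sup>2) \<in> borel_measurable (prodT J)"
    by measurable
qed

lemma measurable_sqsum' [measurable]: "sqsum n \<in> borel_measurable (prodT {..<n})"
  by (rule measurable_sqsum) simp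

definition tailsum :: "nat \<Rightarrow> nat \<Rightarrow> real \<Rightarrow> real" where
  "tailsum m n t = (\<Sum>k\<in>{n..<m}. (cmod (f k t))\<^sup>2)"

lemma tailsum_nonneg: "tailsum m n t \<ge> 0"
  by (simp add: tailsum_def sum_nonneg)

lemma measurable_tailsum [measurable]: "tailsum m n \<in> borel_measurable borel"
  unfolding tailsum_def[abs_def] by measurable

lemma N_dvd_le: "n \<le> k \<Longrightarrow> N n dvd N k"
  by (induction rule: dec_induct) (auto intro: dvd_trans N_dvd)

text \<open>Along the divisibility chain 2 pi / N n is an integer multiple of the period 2 pi / N k
  of each \<open>f k\<close> with k \<ge> n.\<close>

lemma tailsum_periodic: "tailsum m n (t + 2 * pi / real (N n)) = tailsum m n t"
proof -
  have "f k (t + 2 * pi / real (N n)) = f k t" if le: "n \<le> k" for k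
  proof -
    obtain r where r: "N k = N n * r" using N_dvd_le[OF le] by (auto elim: dvdE)
    then have "2 * pi / real (N n) = of_int (int r) * (2 * pi / real (N k))"
      using N_pos[of k] by (auto simp: field_simps)
    then show ?thesis using periodic_int_shift[of "f k", OF periodic] by metis
  qed
  then show ?thesis by (simp add: tailsum_def)
qed

text \<open>The cutoff \<open>m\<close> keeps the sums finite, and a positive
  \<open>\<epsilon>\<close> keeps the radicand away from 0; both are removed by limits at the
  end.\<close>

definition hybrid :: "real \<Rightarrow> nat \<Rightarrow> nat \<Rightarrow> ennreal" where
  "hybrid \<epsilon> m n = (\<integral>\<^sup>+\<omega>. \<integral>\<^sup>+t. ennreal (sqrt (\<epsilon> + sqsum n \<omega> + tailsum m n t)) \<partial>torus_measure \<partial>prodT {..<n})"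

definition increment :: "real \<Rightarrow> nat \<Rightarrow> ennreal" where
  "increment \<epsilon> n = (\<integral>\<^sup>+\<omega>. \<integral>\<^sup>+u. ennreal (excess (\<epsilon> + sqsum n \<omega>) (cmod (f n u))) \<partial>torus_measure \<partial>prodT {..<n})"

definition Lpart :: "nat \<Rightarrow> ennreal" where
  "Lpart m = (\<integral>\<^sup>+t. ennreal (sqrt (\<Sum>k<m. (cmod (f k t))\<^sup>2)) \<partial>torus_measure)"

definition Ipart :: "real \<Rightarrow> nat \<Rightarrow> ennreal" where
  "Ipart \<epsilon> m = (\<integral>\<^sup>+\<omega>. ennreal (sqrt (\<epsilon> + sqsum m \<omega>)) \<partial>prodT {..<m})"

lemma sqsum_update: "sqsum (Suc n) (fun_upd \<omega> n y) = sqsum n \<omega> + (cmod (f n y))\<^sup>2"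
  by (simp add: sqsum_def)

lemma nn_integral_prodT_Suc:
  assumes "g \<in> borel_measurable (prodT {..<Suc n})"
  shows "(\<integral>\<^sup>+\<omega>. g \<omega> \<partial>prodT {..<Suc n}) = (\<integral>\<^sup>+\<omega>. \<integral>\<^sup>+y. g (fun_upd \<omega> n y) \<partial>torus_measure \<partial>prodT {..<n})"
  using assms unfolding lessThan_Suc by (intro product_nn_integral_insert) auto

text \<open>The new root splits pointwise into the old root, constant in the new variable, plus its
  excess; the torus has mass 1. Hence the increments telescope.\<close>

lemma Ipart_Suc:
  assumes "\<epsilon> \<ge> 0" shows "Ipart \<epsilon> (Suc n) = Ipart \<epsilon> n + increment \<epsilon> n"
proof -
  interpret T: sigma_finite_measure torus_measure by (rule sigma_finite_torus)
  have "Ipart \<epsilon> (Suc n) = (\<integral>\<^sup>+\<omega>. \<integral>\<^sup>+y. ennreal (sqrt (\<epsilon> + (sqsum n \<omega> + (cmod (f n y))\<^sup>2))) \<partial>torus_measure \<partial>prodT {..<n})"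
    unfolding Ipart_def by (subst nn_integral_prodT_Suc) (auto simp: sqsum_update)
  also have "\<dots> = (\<integral>\<^sup>+\<omega>. \<integral>\<^sup>+y. ennreal (sqrt (\<epsilon> + sqsum n \<omega>)) + ennreal (excess (\<epsilon> + sqsum n \<omega>) (cmod (f n y))) \<partial>torus_measure \<partial>prodT {..<n})"
  proof (intro nn_integral_cong)
    fix \<omega> y
    show "ennreal (sqrt (\<epsilon> + (sqsum n \<omega> + (cmod (f n y))\<^sup>2))) = ennreal (sqrt (\<epsilon> + sqsum n \<omega>)) + ennreal (excess (\<epsilon> + sqsum n \<omega>) (cmod (f n y)))"
      using assms sqsum_nonneg[of n \<omega>]
      by (subst ennreal_plus[symmetric]) (auto simp: excess_nonneg excess_def add.assoc simp del: ennreal_plus)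
  qed
  also have "\<dots> = (\<integral>\<^sup>+\<omega>. ennreal (sqrt (\<epsilon> + sqsum n \<omega>)) + (\<integral>\<^sup>+y. ennreal (excess (\<epsilon> + sqsum n \<omega>) (cmod (f n y))) \<partial>torus_measure) \<partial>prodT {..<n})"
    by (intro nn_integral_cong) (subst nn_integral_add, auto)
  also have "\<dots> = Ipart \<epsilon> n + increment \<epsilon> n"
    unfolding Ipart_def increment_def excess_def by (rule nn_integral_add) measurable
  finally show ?thesis .
qed

text \<open>With the first n variables fixed, \<open>decouple_torus\<close> applies to A =
  \<epsilon> + sqsum n \<omega>, S = tailsum m (Suc n) and M = N (Suc n). The period of this tail is
  the reason for comparing \<open>d n\<close> with the next N.\<close>

lemma hybrid_step:
  assumes \<epsilon>: "\<epsilon> > 0" and n: "n < m" and \<theta>: "real (d n) / real (N (Suc n)) \<le> \<theta>"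
  shows "hybrid \<epsilon> m n \<le> hybrid \<epsilon> m (Suc n) + ennreal (16 * pi * \<theta>) * increment \<epsilon> n"
    and "hybrid \<epsilon> m (Suc n) \<le> hybrid \<epsilon> m n + ennreal (16 * pi * \<theta>) * increment \<epsilon> n"
proof -
  interpret T: sigma_finite_measure torus_measure by (rule sigma_finite_torus)
  let ?E1 = "\<lambda>\<omega>. \<integral>\<^sup>+t. ennreal (sqrt (\<epsilon> + sqsum n \<omega> + (cmod (f n t))\<^sup>2 + tailsum m (Suc n) t)) \<partial>torus_measure"
  let ?E2 = "\<lambda>\<omega>. \<integral>\<^sup>+u. \<integral>\<^sup>+t. ennreal (sqrt (\<epsilon> + sqsum n \<omega> + (cmod (f n u))\<^sup>2 + tailsum m (Suc n) t)) \<partial>torus_measure \<partial>torus_measure"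
  let ?D = "\<lambda>\<omega>. ennreal (16 * pi * \<theta>) * (\<integral>\<^sup>+u. ennreal (excess (\<epsilon> + sqsum n \<omega>) (cmod (f n u))) \<partial>torus_measure)"
  have h1: "hybrid \<epsilon> m n = (\<integral>\<^sup>+\<omega>. ?E1 \<omega> \<partial>prodT {..<n})"
  proof -
    have "tailsum m n t = (cmod (f n t))\<^sup>2 + tailsum m (Suc n) t" for t
      unfolding tailsum_def using n by (simp add: sum.atLeast_Suc_lessThan)
    then show ?thesis by (simp add: hybrid_def add.assoc)
  qed
  have h2: "hybrid \<epsilon> m (Suc n) = (\<integral>\<^sup>+\<omega>. ?E2 \<omega> \<partial>prodT {..<n})"
    unfolding hybrid_def
    by (subst nn_integral_prodT_Suc) (measurable, simp add: sqsum_update add.assoc)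
  have D: "(\<integral>\<^sup>+\<omega>. ?D \<omega> \<partial>prodT {..<n}) = ennreal (16 * pi * \<theta>) * increment \<epsilon> n"
    unfolding increment_def excess_def by (rule nn_integral_cmult) measurable
  have [measurable]: "?E1 \<in> borel_measurable (prodT {..<n})" "?E2 \<in> borel_measurable (prodT {..<n})"
    "?D \<in> borel_measurable (prodT {..<n})"
    unfolding excess_def by measurable
  have st: "?E1 \<omega> \<le> ?E2 \<omega> + ?D \<omega>" "?E2 \<omega> \<le> ?E1 \<omega> + ?D \<omega>" for \<omega>
  proof -
    have A: "\<epsilon> + sqsum n \<omega> > 0" using \<epsilon> sqsum_nonneg[of n \<omega>] by linarith
    let ?D' = "ennreal (16 * pi * (real (d n) / real (N (Suc n)))) * (\<integral>\<^sup>+u. ennreal (excess (\<epsilon> + sqsum n \<omega>) (cmod (f n u))) \<partial>torus_measure)"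
    note dec = decouple_torus[OF trig_poly d_pos A N_pos tailsum_nonneg measurable_tailsum tailsum_periodic, of n m "Suc n"]
    have "?D' \<le> ?D \<omega>"
      using \<theta> by (intro mult_right_mono ennreal_leI mult_left_mono) auto
    then show "?E1 \<omega> \<le> ?E2 \<omega> + ?D \<omega>" "?E2 \<omega> \<le> ?E1 \<omega> + ?D \<omega>"
      using dec by (meson add_left_mono order_trans)+
  qed
  show "hybrid \<epsilon> m n \<le> hybrid \<epsilon> m (Suc n) + ennreal (16 * pi * \<theta>) * increment \<epsilon> n"
    unfolding h1 h2 D[symmetric]
    by (subst nn_integral_add[symmetric]) (auto intro!: nn_integral_mono st)
  show "hybrid \<epsilon> m (Suc n) \<le> hybrid \<epsilon> m n + ennreal (16 * pi * \<theta>) * increment \<epsilon> n"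
    unfolding h1 h2 D[symmetric]
    by (subst nn_integral_add[symmetric]) (auto intro!: nn_integral_mono st)
qed

text \<open>The errors enter additively, so many steps yield a sum of increments and not a product
  of factors 1 + C \<theta>.\<close>

lemma hybrid_telescope:
  assumes \<epsilon>: "\<epsilon> > 0" and \<theta>: "\<And>k. k < m \<Longrightarrow> real (d k) / real (N (Suc k)) \<le> \<theta>" and "n \<le> m"
  shows "hybrid \<epsilon> m 0 \<le> hybrid \<epsilon> m n + ennreal (16 * pi * \<theta>) * (\<Sum>k<n. increment \<epsilon> k)"
    and "hybrid \<epsilon> m n \<le> hybrid \<epsilon> m 0 + ennreal (16 * pi * \<theta>) * (\<Sum>k<n. increment \<epsilon> k)"
proof -
  let ?c = "ennreal (16 * pi * \<theta>)"
  have "hybrid \<epsilon> m 0 \<le> hybrid \<epsilon> m n + ?c * (\<Sum>k<n. increment \<epsilon> k) \<and>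
      hybrid \<epsilon> m n \<le> hybrid \<epsilon> m 0 + ?c * (\<Sum>k<n. increment \<epsilon> k)"
    using \<open>n \<le> m\<close>
  proof (induction n)
    case (Suc n)
    then have n: "n < m" by simp
    note step = hybrid_step[OF \<epsilon> n \<theta>[OF n]]
    have "hybrid \<epsilon> m 0 \<le> hybrid \<epsilon> m n + ?c * (\<Sum>k<n. increment \<epsilon> k)" using Suc by simp
    also have "\<dots> \<le> (hybrid \<epsilon> m (Suc n) + ?c * increment \<epsilon> n) + ?c * (\<Sum>k<n. increment \<epsilon> k)"
      by (intro add_right_mono step)
    finally have 1: "hybrid \<epsilon> m 0 \<le> hybrid \<epsilon> m (Suc n) + ?c * (\<Sum>k<Suc n. increment \<epsilon> k)"
      by (simp add: distrib_left ac_simps)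
    have "hybrid \<epsilon> m (Suc n) \<le> hybrid \<epsilon> m n + ?c * increment \<epsilon> n" by (rule step)
    also have "\<dots> \<le> (hybrid \<epsilon> m 0 + ?c * (\<Sum>k<n. increment \<epsilon> k)) + ?c * increment \<epsilon> n"
      using Suc by (intro add_right_mono) simp
    finally have 2: "hybrid \<epsilon> m (Suc n) \<le> hybrid \<epsilon> m 0 + ?c * (\<Sum>k<Suc n. increment \<epsilon> k)"
      by (simp add: distrib_left ac_simps)
    from 1 2 show ?case by blast
  qed simp
  then show "hybrid \<epsilon> m 0 \<le> hybrid \<epsilon> m n + ?c * (\<Sum>k<n. increment \<epsilon> k)"
    and "hybrid \<epsilon> m n \<le> hybrid \<epsilon> m 0 + ?c * (\<Sum>k<n. increment \<epsilon> k)"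
    by blast+
qed

lemma Ipart_0: "Ipart \<epsilon> 0 = ennreal (sqrt \<epsilon>)"
  using prob_space.emeasure_space_1[OF prob_space_prodT, of "{..<0}"]
  by (simp add: Ipart_def sqsum_def)

lemma Ipart_sum: "\<epsilon> \<ge> 0 \<Longrightarrow> Ipart \<epsilon> m = ennreal (sqrt \<epsilon>) + (\<Sum>k<m. increment \<epsilon> k)"
  by (induction m) (simp_all add: Ipart_0 Ipart_Suc add.assoc)

lemma hybrid_m: "hybrid \<epsilon> m m = Ipart \<epsilon> m"
  by (simp add: hybrid_def Ipart_def tailsum_def)

lemma hybrid_0: "hybrid \<epsilon> m 0 = (\<integral>\<^sup>+t. ennreal (sqrt (\<epsilon> + (\<Sum>k<m. (cmod (f k t))\<^sup>2))) \<partial>torus_measure)"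
  using prob_space.emeasure_space_1[OF prob_space_prodT, of "{..<0}"]
  by (simp add: hybrid_def sqsum_def tailsum_def atLeast0LessThan)

lemma Ipart_mono: "\<epsilon> \<ge> 0 \<Longrightarrow> Ipart 0 m \<le> Ipart \<epsilon> m"
  unfolding Ipart_def by (intro nn_integral_mono ennreal_leI) simp

lemma Ipart_perturb:
  assumes "\<epsilon> \<ge> 0" shows "Ipart \<epsilon> m \<le> ennreal (sqrt \<epsilon>) + Ipart 0 m"
proof -
  have "Ipart \<epsilon> m \<le> (\<integral>\<^sup>+\<omega>. ennreal (sqrt \<epsilon>) + ennreal (sqrt (0 + sqsum m \<omega>)) \<partial>prodT {..<m})"
    unfolding Ipart_def using ennreal_sqrt_add_le[OF assms sqsum_nonneg] by (intro nn_integral_mono) simp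
  also have "\<dots> = ennreal (sqrt \<epsilon>) + Ipart 0 m"
    unfolding Ipart_def using prob_space.emeasure_space_1[OF prob_space_prodT, of "{..<m}"]
    by (subst nn_integral_add) auto
  finally show ?thesis .
qed

lemma Lpart_mono: "\<epsilon> \<ge> 0 \<Longrightarrow> Lpart m \<le> hybrid \<epsilon> m 0"
  unfolding Lpart_def hybrid_0 by (intro nn_integral_mono ennreal_leI) simp

lemma Lpart_perturb:
  assumes "\<epsilon> \<ge> 0" shows "hybrid \<epsilon> m 0 \<le> ennreal (sqrt \<epsilon>) + Lpart m"
proof -
  have "hybrid \<epsilon> m 0 \<le> (\<integral>\<^sup>+t. ennreal (sqrt \<epsilon>) + ennreal (sqrt (\<Sum>k<m. (cmod (f k t))\<^sup>2)) \<partial>torus_measure)"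
    unfolding hybrid_0 using assms by (intro nn_integral_mono ennreal_sqrt_add_le) (auto intro: sum_nonneg)
  also have "\<dots> = ennreal (sqrt \<epsilon>) + Lpart m"
    unfolding Lpart_def by (subst nn_integral_add) auto
  finally show ?thesis .
qed

text \<open>The sum is the growth of \<open>Ipart \<epsilon>\<close> from its initial value sqrt
  \<epsilon>. Subadditivity of the root bounds \<open>Ipart \<epsilon> m\<close> by sqrt \<epsilon>
  + \<open>Ipart 0 m\<close>, and the finite term sqrt \<epsilon> cancels, leaving a bound free of
  \<epsilon>.\<close>

lemma sum_increment_le:
  assumes "\<epsilon> \<ge> 0" shows "(\<Sum>k<m. increment \<epsilon> k) \<le> Ipart 0 m"
proof -
  have "ennreal (sqrt \<epsilon>) + (\<Sum>k<m. increment \<epsilon> k) \<le> ennreal (sqrt \<epsilon>) + Ipart 0 m"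
    using Ipart_perturb[OF assms] Ipart_sum[OF assms] by metis
  then show ?thesis by (simp add: ennreal_add_left_cancel_le)
qed

text \<open>Both errors involve \<open>Ipart\<close>, since the increments live in the independent
  model. The second bound stays additive until finiteness permits a subtraction.\<close>

lemma partial_bounds:
  assumes \<theta>: "\<And>k. k < m \<Longrightarrow> real (d k) / real (N (Suc k)) \<le> \<theta>"
  shows "Lpart m \<le> Ipart 0 m + ennreal (16 * pi * \<theta>) * Ipart 0 m"
    and "Ipart 0 m \<le> Lpart m + ennreal (16 * pi * \<theta>) * Ipart 0 m"
proof -
  let ?c = "ennreal (16 * pi * \<theta>)"
  show "Lpart m \<le> Ipart 0 m + ?c * Ipart 0 m"
  proof (rule ennreal_le_epsilon)
    fix e :: real assume e: "0 < e"
    \<comment> \<open>The perturbation is chosen as e^2 so that its cost, a square root, is exactly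
      e.\<close>
    then have e2: "e\<^sup>2 > 0" by simp
    have "Lpart m \<le> hybrid (e\<^sup>2) m 0" using e2 by (intro Lpart_mono) auto
    also have "\<dots> \<le> hybrid (e\<^sup>2) m m + ?c * (\<Sum>k<m. increment (e\<^sup>2) k)"
      using e2 \<theta> by (intro hybrid_telescope) auto
    also have "\<dots> \<le> (ennreal (sqrt (e\<^sup>2)) + Ipart 0 m) + ?c * Ipart 0 m"
      unfolding hybrid_m by (intro add_mono mult_left_mono sum_increment_le Ipart_perturb) auto
    finally show "Lpart m \<le> Ipart 0 m + ?c * Ipart 0 m + ennreal e"
      using e by (simp add: ac_simps)
  qed
  show "Ipart 0 m \<le> Lpart m + ?c * Ipart 0 m"
  proof (rule ennreal_le_epsilon)
    fix e :: real assume e: "0 < e"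
    then have e2: "e\<^sup>2 > 0" by simp
    have "Ipart 0 m \<le> hybrid (e\<^sup>2) m m" unfolding hybrid_m using e2 by (intro Ipart_mono) auto
    also have "\<dots> \<le> hybrid (e\<^sup>2) m 0 + ?c * (\<Sum>k<m. increment (e\<^sup>2) k)"
      using e2 \<theta> by (intro hybrid_telescope) auto
    also have "\<dots> \<le> (ennreal (sqrt (e\<^sup>2)) + Lpart m) + ?c * Ipart 0 m"
      by (intro add_mono mult_left_mono sum_increment_le Lpart_perturb) auto
    finally show "Ipart 0 m \<le> Lpart m + ?c * Ipart 0 m + ennreal e"
      using e by (simp add: ac_simps)
  qed
qed

section \<open>From finitely many functions to the full sequence\<close>

lemma Ipart_finite: "Ipart 0 m < top"
proof -
  have "\<forall>k. \<exists>B. \<forall>t. cmod (f k t) \<le> B" using trig_poly_bounded[OF trig_poly] by metis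
  then obtain B where B: "\<And>k t. cmod (f k t) \<le> B k" by metis
  have "Ipart 0 m \<le> (\<integral>\<^sup>+\<omega>. ennreal (sqrt (\<Sum>k<m. (B k)\<^sup>2)) \<partial>prodT {..<m})"
    unfolding Ipart_def sqsum_def
    by (intro nn_integral_mono ennreal_leI) (auto intro!: sum_mono power_mono B)
  also have "\<dots> < top"
    using prob_space.emeasure_space_1[OF prob_space_prodT, of "{..<m}"] by simp
  finally show ?thesis .
qed

text \<open>The finite product is the marginal of the infinite one on the first m coordinates. With
  all partial norms on one space, monotone convergence becomes applicable.\<close>

lemma Ipart_eq: "Ipart 0 m = (\<integral>\<^sup>+\<omega>. ennreal (sqrt (sqsum m \<omega>)) \<partial>prodT UNIV)"
proof -
  have "Ipart 0 m = (\<integral>\<^sup>+\<omega>. ennreal (sqrt (sqsum m \<omega>)) \<partial>distr (prodT UNIV) (prodT {..<m}) (\<lambda>x. restrict x {..<m}))"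
    by (subst distr_PiM_restrict_finite) (auto simp: Ipart_def)
  also have "\<dots> = (\<integral>\<^sup>+\<omega>. ennreal (sqrt (sqsum m (restrict \<omega> {..<m}))) \<partial>prodT UNIV)"
    by (rule nn_integral_distr) (auto intro!: measurable_restrict_subset)
  finally show ?thesis by (simp add: sqsum_def)
qed

lemma ind_norm_eq: "ind_norm f = (SUP m. Ipart 0 m)"
  unfolding ind_norm_def sqfun_def Ipart_eq sqsum_def
  by (rule nn_integral_monotone_convergence_SUP)
     (auto intro!: incseq_SucI le_funI ennreal_leI measurable_sqsum[unfolded sqsum_def[abs_def]] 
        measurable_compose[OF _ measurable_ennreal] borel_measurable_sqrt)

lemma L1l2_norm_eq: "L1l2_norm f = (SUP m. Lpart m)"
  unfolding L1l2_norm_def sqfun_def Lpart_def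
  by (rule nn_integral_monotone_convergence_SUP)
     (auto intro!: incseq_SucI le_funI ennreal_leI)

lemma L1l2_norm_upper:
  assumes "r \<ge> 0" "\<And>k. real (d k) / real (N (Suc k)) \<le> r"
  shows "L1l2_norm f \<le> ennreal (1 + 16 * pi * r) * ind_norm f"
  unfolding L1l2_norm_eq
proof (rule SUP_least)
  fix m
  have "Lpart m \<le> Ipart 0 m + ennreal (16 * pi * r) * Ipart 0 m"
    using assms by (intro partial_bounds) auto
  also have "\<dots> = ennreal (1 + 16 * pi * r) * Ipart 0 m"
    using assms by (simp add: distrib_right)
  also have "\<dots> \<le> ennreal (1 + 16 * pi * r) * ind_norm f"
    unfolding ind_norm_eq by (intro mult_left_mono SUP_upper) auto
  finally show "Lpart m \<le> ennreal (1 + 16 * pi * r) * ind_norm f" .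
qed

lemma L1l2_norm_lower:
  assumes "r \<ge> 0" "\<And>k. real (d k) / real (N (Suc k)) \<le> r" and small: "16 * pi * r \<le> 1"
  shows "ennreal (1 - 16 * pi * r) * ind_norm f \<le> L1l2_norm f"
  unfolding ind_norm_eq SUP_mult_left_ennreal
proof (rule SUP_least)
  fix m
  \<comment> \<open>The subtraction takes place at the level of partial norms, which are finite;
    their supremum may be infinite.\<close>
  obtain x where x: "x \<ge> 0" "Ipart 0 m = ennreal x"
    using Ipart_finite[of m] by (cases "Ipart 0 m") auto
  have "Ipart 0 m \<le> Lpart m + ennreal (16 * pi * r) * Ipart 0 m"
    using assms by (intro partial_bounds) auto
  then have "ennreal x \<le> Lpart m + ennreal (16 * pi * r * x)"
    using x assms by (simp add: ennreal_mult)
  then have "ennreal ((1 - 16 * pi * r) * x) \<le> Lpart m"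
    using x(1) assms by (cases "Lpart m") (auto simp: algebra_simps simp flip: ennreal_plus)
  then have "ennreal (1 - 16 * pi * r) * Ipart 0 m \<le> Lpart m"
    using x small by (simp add: ennreal_mult)
  also have "\<dots> \<le> L1l2_norm f"
    unfolding L1l2_norm_eq by (intro SUP_upper) auto
  finally show "ennreal (1 - 16 * pi * r) * Ipart 0 m \<le> L1l2_norm f" .
qed

text \<open>This settles the upper bound for infinite \<theta> when its right-hand side is the
  product of infinity and 0, which is 0 in \<open>ereal\<close>.\<close>

lemma L1l2_norm_eq_0:
  assumes "ind_norm f = 0" shows "L1l2_norm f = 0"
proof -
  have "Lpart m = 0" for m
  proof -
    have "Ipart 0 m \<le> ind_norm f" unfolding ind_norm_eq by (intro SUP_upper) auto
    then have "Ipart 0 m = 0" using assms by simp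
    \<comment> \<open>For fixed \<open>m\<close> any finite bound on the first m ratios will do, and
      their sum is one.\<close>
    moreover have "Lpart m \<le> Ipart 0 m + ennreal (16 * pi * (\<Sum>k<m. real (d k) / real (N (Suc k)))) * Ipart 0 m"
      by (intro partial_bounds member_le_sum) auto
    ultimately show ?thesis by simp
  qed
  then show ?thesis by (simp add: L1l2_norm_eq)
qed

lemma norm_comparison:
  fixes \<theta> :: ereal
  defines "\<theta> \<equiv> SUP k. ereal (real (d k) / real (N (Suc k)))"
  shows "(1 - ereal (16 * pi) * \<theta>) * enn2ereal (ind_norm f) \<le> enn2ereal (L1l2_norm f)"
    and "enn2ereal (L1l2_norm f) \<le> (1 + ereal (16 * pi) * \<theta>) * enn2ereal (ind_norm f)"
proof -
  have le: "ereal (real (d k) / real (N (Suc k))) \<le> \<theta>" for k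
    unfolding \<theta>_def by (intro SUP_upper) auto
  have \<theta>0: "\<theta> \<ge> 0"
    using le[of 0] order_trans[of 0 "ereal (real (d 0) / real (N (Suc 0)))" \<theta>] by simp
  have conv: "enn2ereal (ennreal a * b) = ereal a * enn2ereal b" if "a \<ge> 0" for a b
    using that by (simp add: times_ennreal.rep_eq enn2ereal_ennreal)
  show "(1 - ereal (16 * pi) * \<theta>) * enn2ereal (ind_norm f) \<le> enn2ereal (L1l2_norm f)"
  proof (cases "ereal (16 * pi) * \<theta> \<le> 1")
    case True
    then obtain r where r: "\<theta> = ereal r" using \<theta>0 by (cases \<theta>) auto
    have *: "r \<ge> 0" "\<And>k. real (d k) / real (N (Suc k)) \<le> r" "16 * pi * r \<le> 1"
      using \<theta>0 le True unfolding r by auto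
    from L1l2_norm_lower[OF *] have "enn2ereal (ennreal (1 - 16 * pi * r) * ind_norm f) \<le> enn2ereal (L1l2_norm f)"
      by (simp only: less_eq_ennreal.rep_eq)
    then show ?thesis using *(3) by (simp add: conv r one_ereal_def)
  \<comment> \<open>Here the left factor is negative, possibly minus infinity, and the lower bound
    is trivial.\<close>
  next
    case False
    then have "1 - ereal (16 * pi) * \<theta> \<le> 0"
      by (cases "ereal (16 * pi) * \<theta>") (auto simp: one_ereal_def)
    then have "(1 - ereal (16 * pi) * \<theta>) * enn2ereal (ind_norm f) \<le> 0"
      by (simp add: ereal_mult_le_0_iff)
    then show ?thesis by (meson enn2ereal_nonneg order_trans)
  qed
  show "enn2ereal (L1l2_norm f) \<le> (1 + ereal (16 * pi) * \<theta>) * enn2ereal (ind_norm f)"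
  proof (cases \<theta>)
    case (real r)
    have *: "r \<ge> 0" "\<And>k. real (d k) / real (N (Suc k)) \<le> r"
      using \<theta>0 le unfolding real by auto
    from L1l2_norm_upper[OF *] have "enn2ereal (L1l2_norm f) \<le> enn2ereal (ennreal (1 + 16 * pi * r) * ind_norm f)"
      by (simp only: less_eq_ennreal.rep_eq)
    then show ?thesis using *(1) by (simp add: conv real one_ereal_def del: ennreal_plus)
  next
    case PInf
    show ?thesis
    proof (cases "ind_norm f = 0")
      case True
      then show ?thesis using L1l2_norm_eq_0 by (simp add: zero_ennreal.rep_eq)
    next
      case False
      then have "enn2ereal (ind_norm f) > 0"
        by (metis enn2ereal_nonneg order_le_less zero_ennreal.rep_eq enn2ereal_inject)
      then show ?thesis using PInf by (auto simp: one_ereal_def)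
    qed
  next
    case MInf
    then show ?thesis using \<theta>0 by simp
  qed
qed

end

theorem theorem5p8:
  "\<exists>C::real. C > 0 \<and>
     (\<forall>(N :: nat \<Rightarrow> nat) (d :: nat \<Rightarrow> nat) (f :: nat \<Rightarrow> real \<Rightarrow> complex).
        (\<forall>k. N k > 0 \<and> N k dvd N (Suc k) \<and> d k > 0 \<and> trig_poly_deg_le (f k) (d k) \<and>
             (\<forall>t. f k (t + 2 * pi / real (N k)) = f k t)) \<longrightarrow>
        (let \<theta> = (SUP k. ereal (real (d k) / real (N (Suc k)))) in
           (1 - ereal C * \<theta>) * enn2ereal (ind_norm f) \<le> enn2ereal (L1l2_norm f) \<and>
           enn2ereal (L1l2_norm f) \<le> (1 + ereal C * \<theta>) * enn2ereal (ind_norm f)))"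
proof (intro exI[of _ "16 * pi"] conjI allI impI)
  fix N d :: "nat \<Rightarrow> nat" and f :: "nat \<Rightarrow> real \<Rightarrow> complex"
  assume "\<forall>k. N k > 0 \<and> N k dvd N (Suc k) \<and> d k > 0 \<and> trig_poly_deg_le (f k) (d k) \<and>
             (\<forall>t. f k (t + 2 * pi / real (N k)) = f k t)"
  then interpret periodic_trig_polys N d f by unfold_locales auto
  show "let \<theta> = (SUP k. ereal (real (d k) / real (N (Suc k)))) in
           (1 - ereal (16 * pi) * \<theta>) * enn2ereal (ind_norm f) \<le> enn2ereal (L1l2_norm f) \<and>
           enn2ereal (L1l2_norm f) \<le> (1 + ereal (16 * pi) * \<theta>) * enn2ereal (ind_norm f)"
    unfolding Let_def using norm_comparison by blast
qed simp

end
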